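(* Let $d<0$ be a fundamental discriminant and let $D<0$ be a discriminant such that $Dd$ is not a perfect square. Then for every $x\in\mathbb{Q}$, \[ F_{1,D,d}(x)=0 . \]
   Context: A discriminant is an integer $D\equiv 0,1\pmod 4$. A fundamental discriminant is $1$ or the discriminant of a quadratic field. $\left(\frac{\cdot}{\cdot}\right)$ denotes the Kronecker symbol (in particular $\left(\frac{d}{-1}\right)=\operatorname{sign}(d)$). $[a,b,c]$ denotes the quadratic function $Q(x)=ax^2+bx+c$ with $a,b,c\in\mathbb{Z}$; for an integer $\Delta>0$, $\mathfrak{Q}_\Delta$ is the set of all such $Q$ with $b^2-4ac=\Delta$. Genus character: let $d$ be a fundamental discriminant and $D$ a discriminant with $Dd>0$. For $Q=[a,b,c]\in\mathfrak{Q}_{Dd}$ put $\chi_d(Q)=0$ if $\gcd(a,b,c,d)>1$, and $\chi_d(Q)=\left(\frac{d}{r}\right)$ if $\gcd(a,b,c,d)=1$, where $r$ is any integer coprime to $d$ represented by the binary form $aX^2+bXY+cY^2$ with $X,Y\in\mathbb{Z}$ (the value does not depend on the choice of $r$). For $x\in\mathbb{Q}$, \[ F_{1,D,d}(x)=\sum_{\substack{Q=[a,b,c]\in\mathfrak{Q}_{Dd}\\ a<0<Q(x)}}\chi_d(Q), \] which is the case $k=1$ of $F_{k,D,d}(x)=\sum_{Q\in\mathfrak{Q}_{Dd},\,a<0<Q(x)}\chi_d(Q)Q(x)^{k-1}$; the sum is well defined (finite) for rational $x$. *)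

theory Defs
  imports
    "HOL-Computational_Algebra.Computational_Algebra"
    "HOL-Number_Theory.Number_Theory"
begin

subsection \<open>Kronecker symbol\<close>

definition kronecker_prime :: "int \<Rightarrow> int \<Rightarrow> int" where
  "kronecker_prime a p =
     (if p = 2 then (if even a then 0 else if a mod 8 \<in> {1, 7} then 1 else -1)
      else Legendre a p)"

(* prime_factors n consists of the positive primes dividing n, also for n < 0; the unit part
   of n is accounted for by the sign factor. *)
definition kronecker :: "int \<Rightarrow> int \<Rightarrow> int" where
  "kronecker a n =
     (if n = 0 then (if \<bar>a\<bar> = 1 then 1 else 0)
      else (if n < 0 \<and> a < 0 then -1 else 1) *
           (\<Prod>p\<in>prime_factors n. kronecker_prime a p ^ multiplicity p n))"

subsection \<open>Discriminants\<close>

definition discriminant :: "int \<Rightarrow> bool" where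
  "discriminant D \<longleftrightarrow> D mod 4 \<in> {0, 1}"

(* The element u + v sqrt m of the field Q(sqrt m), embedded in the complex numbers.  Its
   conjugate is quad_elt m u (- v). *)
definition quad_elt :: "int \<Rightarrow> rat \<Rightarrow> rat \<Rightarrow> complex" where
  "quad_elt m u v = of_rat u + of_rat v * csqrt (of_int m)"

definition quadratic_field :: "int \<Rightarrow> complex set" where
  "quadratic_field m = {quad_elt m u v | u v. True}"

definition quadratic_integers :: "int \<Rightarrow> complex set" where
  "quadratic_integers m = {z \<in> quadratic_field m. algebraic_int z}"

(* For squarefree m other than 1: d is the discriminant of Q(sqrt m), that is, the square of the
   determinant of the matrix of conjugates of a Z-basis (w1, w2) of the ring of integers. *)
definition is_field_discriminant :: "int \<Rightarrow> int \<Rightarrow> bool" where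
  "is_field_discriminant m d \<longleftrightarrow>
     (\<exists>u1 v1 u2 v2. \<exists>w1 w2 w1' w2'.
        w1 = quad_elt m u1 v1 \<and> w1' = quad_elt m u1 (- v1) \<and>
        w2 = quad_elt m u2 v2 \<and> w2' = quad_elt m u2 (- v2) \<and>
        bij_betw (\<lambda>(s, t). of_int s * w1 + of_int t * w2)
          (UNIV :: (int \<times> int) set) (quadratic_integers m) \<and>
        of_int d = (w1 * w2' - w2 * w1')\<^sup>2)"

definition fundamental_discriminant :: "int \<Rightarrow> bool" where
  "fundamental_discriminant d \<longleftrightarrow>
     d = 1 \<or> (\<exists>m. squarefree m \<and> m \<noteq> 1 \<and> is_field_discriminant m d)"

subsection \<open>Quadratic functions and the genus character\<close>

(* The triple (a, b, c) stands for [a, b, c]. *)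
type_synonym quad = "int \<times> int \<times> int"

definition quads :: "int \<Rightarrow> quad set" where
  "quads \<Delta> = {(a, b, c). b\<^sup>2 - 4 * a * c = \<Delta>}"

fun lead :: "quad \<Rightarrow> int" where
  "lead (a, b, c) = a"

fun quad_eval :: "quad \<Rightarrow> rat \<Rightarrow> rat" where
  "quad_eval (a, b, c) x = of_int a * x\<^sup>2 + of_int b * x + of_int c"

fun represents :: "quad \<Rightarrow> int \<Rightarrow> bool" where
  "represents (a, b, c) r \<longleftrightarrow> (\<exists>X Y. r = a * X\<^sup>2 + b * X * Y + c * Y\<^sup>2)"

(* For d a fundamental discriminant and (a, b, c) of discriminant D d with D a discriminant,
   the value does not depend on the r that is chosen. *)
fun genus_char :: "int \<Rightarrow> quad \<Rightarrow> int" where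
  "genus_char d (a, b, c) =
     (if gcd (gcd a b) (gcd c d) > 1 then 0
      else kronecker d (SOME r. coprime r d \<and> represents (a, b, c) r))"

subsection \<open>The sums\<close>

definition F_index :: "int \<Rightarrow> rat \<Rightarrow> quad set" where
  "F_index \<Delta> x = {Q \<in> quads \<Delta>. lead Q < 0 \<and> 0 < quad_eval Q x}"

definition F :: "nat \<Rightarrow> int \<Rightarrow> int \<Rightarrow> rat \<Rightarrow> rat" where
  "F k D d x = (\<Sum>Q\<in>F_index (D * d) x. of_int (genus_char d Q) * quad_eval Q x ^ (k - 1))"

(* The sum in F is a genuine finite sum, not the default value 0 of sum over an infinite set. *)
lemma finite_F_index: "finite (F_index \<Delta> x)"
proof -
  obtain p q where pq: "quotient_of x = (p, q)" by fastforce
  have q: "q > 0" and x: "x = of_int p / of_int q"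
    using quotient_of_denom_pos[OF pq] quotient_of_div[OF pq] by auto
  define M where "M = \<Delta> * q\<^sup>2"
  define g where "g = (\<lambda>(a, b, c :: int). (a, 2 * a * p + b * q))"
  have "inj_on g (F_index \<Delta> x)"
    using q by (auto simp: inj_on_def g_def F_index_def quads_def)
  moreover have "g ` F_index \<Delta> x \<subseteq> {-M..M} \<times> {-M..M}"
  proof clarify
    fix a b c u v
    assume Q: "(a, b, c) \<in> F_index \<Delta> x" and g: "(u, v) = g (a, b, c)"
    define N where "N = a * p\<^sup>2 + b * p * q + c * q\<^sup>2"
    have a: "a < 0" and \<Delta>: "b\<^sup>2 - 4 * a * c = \<Delta>" and pos: "0 < quad_eval (a, b, c) x"
      using Q by (auto simp: F_index_def quads_def)
    have "of_int N = quad_eval (a, b, c) x * (of_int q)\<^sup>2"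
      using q by (simp add: N_def x field_simps power2_eq_square)
    also have "\<dots> > 0" using pos q by simp
    finally have N: "N \<ge> 1" by linarith
    have v: "v = 2 * a * p + b * q" and u: "u = a" using g by (auto simp: g_def)
    have M: "M = v\<^sup>2 + 4 * (- a) * N"
      unfolding M_def \<Delta>[symmetric] v N_def by (simp add: algebra_simps power2_eq_square)
    have "(- a) * 1 \<le> (- a) * N" using a N by (intro mult_left_mono) auto
    hence aM: "4 * (- a) + v\<^sup>2 \<le> M" using M by simp
    have "\<bar>v\<bar> \<le> v\<^sup>2"
    proof (cases "v = 0")
      case False
      then have "\<bar>v\<bar> ^ 1 \<le> \<bar>v\<bar> ^ 2" by (intro power_increasing) auto
      then show ?thesis by simp
    qed simp
    with aM a have "\<bar>v\<bar> \<le> M" by linarith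
    moreover have "\<bar>u\<bar> \<le> M" using aM a u zero_le_power2[of v] by linarith
    ultimately show "u \<in> {-M..M} \<and> v \<in> {-M..M}" by auto
  qed
  ultimately show ?thesis by (rule inj_on_finite) auto
qed

end

theory Submission
  imports Defs
begin

text \<open>
  Write \<open>\<chi>\<close> for the genus character and \<open>\<Delta> = D d\<close>. The sum vanishes because of three symmetries of
  \<open>\<chi>\<close>: it takes the same value on \<open>[a, b, c]\<close>, on the form with \<open>x\<close> replaced by \<open>x + 1\<close>, and on
  \<open>[c, b, a]\<close>, because these represent the same integers; and \<open>\<chi> (- Q) = - \<chi> Q\<close>, because
  \<open>(d/-1) = -1\<close> for \<open>d < 0\<close>.

  The translation gives \<open>F (x + 1) = F x\<close>. The swap \<open>Q \<mapsto> [c, b, a]\<close> turns \<open>F (1/x)\<close> into the sum of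
  \<open>\<chi>\<close> over the \<open>Q\<close> with \<open>c < 0 < Q(x)\<close>. Comparing this with \<open>F x\<close>, the forms with \<open>a, c < 0\<close> cancel.
  The remaining ones have \<open>a < 0 < c\<close> on one side and \<open>c < 0 < a\<close> on the other (no coefficient vanishes and
  no rational \<open>x\<close> is a root, as \<open>\<Delta>\<close> is not a square), and negating the latter shows that
  \<open>F x - F (1/x)\<close> is the sum \<open>S\<close> of \<open>\<chi>\<close> over all forms with \<open>a < 0 < c\<close>, whatever \<open>x\<close> is. The
  involution \<open>[a, b, c] \<mapsto> [-c, -b, -a]\<close> of this set reverses the sign of \<open>\<chi>\<close>, so \<open>S = 0\<close>. Thus \<open>F\<close> is
  invariant under \<open>x \<mapsto> x + 1\<close> and \<open>x \<mapsto> 1/x\<close>, and Euclid's algorithm makes it constant on the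
  rationals, with value \<open>F 0 = S = 0\<close>. This is \<open>sum_odd_invariant_zero\<close>.

  Most of the text proves that \<open>\<chi>\<close> is odd. As \<open>\<chi>\<close> picks some represented integer prime to
  \<open>d\<close>, this requires that all of them give the same value (\<open>represented_coprime_kronecker_eq\<close>). For two
  represented integers \<open>r\<close> and \<open>s\<close>, composition of forms gives \<open>4 r s = B\<^sup>2 - D d T\<^sup>2\<close>, so \<open>r s\<close> is a
  square modulo every odd prime divisor of \<open>d\<close> and, for even \<open>d\<close>, lies in prescribed classes
  modulo 8; that this forces \<open>(d/r s) = 1\<close> is quadratic reciprocity, applied to a factorization of \<open>d\<close> into prime
  discriminants and one of \<open>1, -4, 8, -8\<close>. That \<open>d\<close> has such a factorization follows from the integral
  basis that defines it (\<open>fundamental_discriminant_mod_16\<close>).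
\<close>

section \<open>Legendre symbols modulo odd primes\<close>

lemma Legendre_values: "Legendre a p \<in> {-1, 0, 1}"
  by (simp add: Legendre_def)

lemma cong_sign_imp_eq:
  fixes x y :: int
  assumes "p > 2" "x \<in> {-1, 0, 1}" "y \<in> {-1, 0, 1}" "[x = y] (mod p)"
  shows "x = y"
proof -
  have dvd: "p dvd x - y" using assms(4) by (simp add: cong_iff_dvd_diff)
  have "\<bar>x - y\<bar> < p" using assms(1-3) by auto
  then show ?thesis using dvd_imp_le_int[OF _ dvd] by force
qed

lemma euler_criterion_int:
  fixes p :: int
  assumes "prime p" "p > 2"
  shows "[Legendre a p = a ^ nat ((p - 1) div 2)] (mod p)"
proof -
  have "[Legendre a (int (nat p)) = a ^ ((nat p - 1) div 2)] (mod int (nat p))"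
    using assms by (intro euler_criterion) auto
  moreover have "(nat p - 1) div 2 = nat ((p - 1) div 2)" using assms by linarith
  ultimately show ?thesis using assms by simp
qed

lemma Legendre_mult:
  fixes p :: int
  assumes "prime p" "p > 2"
  shows "Legendre (a * b) p = Legendre a p * Legendre b p"
proof (rule cong_sign_imp_eq[OF assms(2)])
  have "[Legendre a p * Legendre b p = (a * b) ^ nat ((p - 1) div 2)] (mod p)"
    unfolding power_mult_distrib by (intro cong_mult euler_criterion_int assms)
  then show "[Legendre (a * b) p = Legendre a p * Legendre b p] (mod p)"
    using euler_criterion_int[OF assms] cong_sym cong_trans by blast
qed (use Legendre_values[of a p] Legendre_values[of b p] Legendre_values[of "a * b" p] in auto)

lemma odd_prime_mod_4:
  fixes p :: int
  assumes "prime p" "p > 2"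
  shows "p mod 4 = 1 \<or> p mod 4 = 3"
proof -
  have "odd p" using assms prime_odd_int by blast
  then show ?thesis by presburger
qed

lemma Legendre_minus_one:
  fixes p :: int
  assumes "prime p" "p > 2"
  shows "Legendre (- 1) p = (if p mod 4 = 1 then 1 else - 1)"
proof (rule cong_sign_imp_eq[OF assms(2)])
  have "even (nat ((p - 1) div 2)) \<longleftrightarrow> p mod 4 = 1"
    using odd_prime_mod_4[OF assms] assms(2)
    by (simp add: even_nat_iff) presburger
  then show "[Legendre (- 1) p = (if p mod 4 = 1 then 1 else - 1)] (mod p)"
    using euler_criterion_int[OF assms, of "- 1"] by (auto simp: minus_one_power_iff simp del: even_nat_iff)
qed (use Legendre_values in auto)

text \<open>The second supplement, from Gauss's lemma: with \<open>h = (p - 1) / 2\<close>, the multiples \<open>2, 4, ..., 2 h\<close> are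
  their own residues, and those above \<open>h\<close> are the \<open>2 x\<close> with \<open>h div 2 < x \<le> h\<close>.\<close>

lemma Legendre_two:
  fixes p :: int
  assumes "prime p" "p > 2"
  shows "Legendre 2 p = (if p mod 8 \<in> {1, 7} then 1 else - 1)"
proof -
  interpret GAUSS "nat p" 2
  proof
    show "prime (nat p)" using assms(1) by simp
    show "[2 \<noteq> 0] (mod int (nat p))" using assms(2) by (simp add: cong_def)
  qed (use assms(2) in auto)
  define h where "h = (p - 1) div 2"
  have p: "p = 2 * h + 1" using p_eq2 assms(2) by (simp add: h_def)
  have "C = (\<lambda>x. 2 * x) ` {0<..h}"
    unfolding C_def B_def A_def image_image using assms(2)
    by (intro image_cong) (auto simp: h_def mult.commute)
  then have "E = (\<lambda>x. 2 * x) ` {h div 2<..h}"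
    unfolding E_def using assms(2) by (auto simp: h_def[symmetric] image_iff p)
  then have "card E = nat (h - h div 2)"
    by (simp add: card_image inj_on_def)
  then have "Legendre 2 p = (- 1) ^ nat (h - h div 2)"
    using gauss_lemma assms(2) by simp
  moreover have "even (nat (h - h div 2)) \<longleftrightarrow> p mod 8 \<in> {1, 7}"
    using p assms(2) by (simp add: even_nat_iff) presburger
  ultimately show ?thesis by (auto simp: minus_one_power_iff)
qed

lemma Legendre_square_eq_1:
  assumes "prime q" "\<not> q dvd x"
  shows "Legendre (x\<^sup>2) q = 1"
  using assms by (auto simp: Legendre_def QuadRes_def cong_0_iff prime_dvd_power_iff intro: exI[of _ x])

section \<open>The Kronecker symbol and quadratic reciprocity\<close>

text \<open>For \<open>S = {1, 5}, {1, 7}, {1, 3}\<close>, a subgroup of index 2 in the units modulo 8, this is the Dirichlet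
  character with kernel \<open>S\<close>: the one attached to the discriminant \<open>-4\<close>, \<open>8\<close>, \<open>-8\<close>, respectively.\<close>

definition residue_sign :: "int set \<Rightarrow> int \<Rightarrow> int" where
  "residue_sign S n = (if even n then 0 else if n mod 8 \<in> S then 1 else - 1)"

lemma odd_mod_8: "odd (n :: int) \<Longrightarrow> n mod 8 \<in> {1, 3, 5, 7}"
  by simp presburger

lemma residue_sign_mult:
  assumes "S \<in> {{1, 3}, {1, 5}, {1, 7}}"
  shows "residue_sign S (a * b) = residue_sign S a * residue_sign S b"
proof (cases "odd a \<and> odd b")
  case True
  define u v where "u = a mod 8" and "v = b mod 8"
  have uv: "a * b mod 8 = u * v mod 8" by (simp add: u_def v_def mod_mult_eq)
  have "u \<in> {1, 3, 5, 7}" "v \<in> {1, 3, 5, 7}"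
    unfolding u_def v_def using odd_mod_8 True by blast+
  then show ?thesis
    using True assms unfolding residue_sign_def uv u_def[symmetric] v_def[symmetric]
    by fastforce
qed (auto simp: residue_sign_def)

lemma kronecker_prime_2: "kronecker_prime a 2 = residue_sign {1, 7} a"
  by (simp add: kronecker_prime_def residue_sign_def)

lemma kronecker_prime_mult:
  assumes "prime p"
  shows "kronecker_prime (a * b) p = kronecker_prime a p * kronecker_prime b p"
proof (cases "p = 2")
  case False
  then show ?thesis
    using Legendre_mult assms prime_ge_2_int[OF assms] by (simp add: kronecker_prime_def)
qed (simp add: kronecker_prime_2 residue_sign_mult)

lemma kronecker_mult_left:
  assumes "a \<noteq> 0" "b \<noteq> 0"
  shows "kronecker (a * b) n = kronecker a n * kronecker b n"
proof (cases "n = 0")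
  case True
  have "\<bar>a * b\<bar> = 1 \<longleftrightarrow> \<bar>a\<bar> = 1 \<and> \<bar>b\<bar> = 1"
    by (metis abs_mult abs_zmult_eq_1 mult.commute mult_1)
  then show ?thesis using True by (auto simp: kronecker_def)
next
  case False
  have "(\<Prod>p\<in>prime_factors n. kronecker_prime (a * b) p ^ multiplicity p n) =
    (\<Prod>p\<in>prime_factors n. kronecker_prime a p ^ multiplicity p n) *
    (\<Prod>p\<in>prime_factors n. kronecker_prime b p ^ multiplicity p n)"
    unfolding prod.distrib[symmetric]
    by (intro prod.cong refl) (simp add: kronecker_prime_mult power_mult_distrib in_prime_factors_iff)
  then show ?thesis using False assms
    by (auto simp: kronecker_def mult_less_0_iff)
qed

text \<open>Allowing factors with exponent 0 makes one index set serve for \<open>n\<close>, \<open>m\<close> and \<open>n m\<close>, so that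
  multiplicativity in the lower argument can be checked factor by factor.\<close>

lemma kronecker_eq_prod:
  assumes "n \<noteq> 0" "finite P" "prime_factors n \<subseteq> P" "\<And>p. p \<in> P \<Longrightarrow> prime p"
  shows "kronecker a n =
    (if n < 0 \<and> a < 0 then - 1 else 1) * (\<Prod>p\<in>P. kronecker_prime a p ^ multiplicity p n)"
proof -
  have "multiplicity p n = 0" if "p \<in> P - prime_factors n" for p
    using that assms by (intro not_dvd_imp_multiplicity_0) (auto simp: in_prime_factors_iff)
  then have "(\<Prod>p\<in>prime_factors n. kronecker_prime a p ^ multiplicity p n) =
      (\<Prod>p\<in>P. kronecker_prime a p ^ multiplicity p n)"
    using assms by (intro prod.mono_neutral_left) auto
  then show ?thesis using assms(1) by (simp add: kronecker_def)
qed

lemma kronecker_mult_right: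
  assumes "n \<noteq> 0" "m \<noteq> 0"
  shows "kronecker a (n * m) = kronecker a n * kronecker a m"
proof -
  define P where "P = prime_factors (n * m)"
  have P: "prime_factors n \<subseteq> P" "prime_factors m \<subseteq> P" "finite P" "\<And>p. p \<in> P \<Longrightarrow> prime p"
    using assms by (auto simp: P_def in_prime_factors_iff)
  have "(\<Prod>p\<in>P. kronecker_prime a p ^ multiplicity p (n * m)) =
      (\<Prod>p\<in>P. kronecker_prime a p ^ multiplicity p n) * (\<Prod>p\<in>P. kronecker_prime a p ^ multiplicity p m)"
    unfolding prod.distrib[symmetric]
  proof (intro prod.cong refl)
    fix p assume "p \<in> P"
    then have "prime_elem p" using P(4) by blast
    from prime_elem_multiplicity_mult_distrib[OF this assms]
    show "kronecker_prime a p ^ multiplicity p (n * m) =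
        kronecker_prime a p ^ multiplicity p n * kronecker_prime a p ^ multiplicity p m"
      by (simp add: power_add)
  qed
  then show ?thesis
    using assms P kronecker_eq_prod[of n P a] kronecker_eq_prod[of m P a]
      kronecker_eq_prod[of "n * m" P a]
    by (auto simp: P_def mult_less_0_iff)
qed

lemma kronecker_minus_one: "kronecker a (- 1) = (if a < 0 then - 1 else 1)"
  by (simp add: kronecker_def)

lemma kronecker_of_prime: "prime p \<Longrightarrow> kronecker a p = kronecker_prime a p"
  using prime_gt_0_int[of p] by (simp add: kronecker_def prime_prime_factors)

text \<open>The lower argument is a product of primes and a sign, so a reciprocity law only has to be checked at
  primes and at \<open>- 1\<close>.\<close>

lemma kronecker_eqI:
  fixes f :: "int \<Rightarrow> int"
  assumes prime: "\<And>p. prime p \<Longrightarrow> f p = kronecker_prime a p"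
    and mult: "\<And>p n. prime p \<Longrightarrow> n \<noteq> 0 \<Longrightarrow> f (p * n) = f p * f n"
    and one: "f 1 = 1" and minus_one: "f (- 1) = (if a < 0 then - 1 else 1)"
    and n: "n \<noteq> 0"
  shows "kronecker a n = f n"
  using n
proof (induction n rule: prime_divisors_induct)
  case (unit x)
  then have "x = 1 \<or> x = - 1" by (simp add: abs_if split: if_splits)
  then show ?case by (auto simp: kronecker_def one minus_one)
next
  case (factor p n)
  then show ?case
    by (auto simp: kronecker_mult_right kronecker_of_prime prime mult)
qed auto

lemma kronecker_one: "n \<noteq> 0 \<Longrightarrow> kronecker 1 n = 1"
proof (rule kronecker_eqI)
  fix p :: int assume "prime p"
  then show "1 = kronecker_prime 1 p"
    using Legendre_square_eq_1[of p 1] not_prime_unit[of p] by (auto simp: kronecker_prime_def)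
qed auto

text \<open>The odd prime \<open>q\<close> with the sign that makes it congruent to 1 modulo 4, hence a discriminant.\<close>

definition prime_disc :: "int \<Rightarrow> int" where
  "prime_disc q = (if q mod 4 = 1 then q else - q)"

text \<open>Quadratic reciprocity with both supplements in a single formula: the sign in \<open>prime_disc\<close> absorbs the
  sign of the reciprocity law at odd \<open>p\<close>, the value modulo 8 decides \<open>p = 2\<close>, and the sign of the
  discriminant is the value at \<open>- 1\<close>.\<close>

lemma kronecker_prime_disc:
  fixes q :: int
  assumes q: "prime q" "q > 2" and n: "n \<noteq> 0"
  shows "kronecker (prime_disc q) n = Legendre n q"
  \<comment> \<open>The blanks leave the four conditions on the function as goals and discharge only \<open>n \<noteq> 0\<close>.\<close>
  using _ _ _ _ n
proof (rule kronecker_eqI)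
  fix p n :: int assume "prime p" "n \<noteq> 0"
  then show "Legendre (p * n) q = Legendre p q * Legendre n q" by (intro Legendre_mult q)
next
  show "Legendre 1 q = 1"
    using q Legendre_square_eq_1[of q 1] not_prime_unit[of q] by auto
next
  show "Legendre (- 1) q = (if prime_disc q < 0 then - 1 else 1)"
    using q Legendre_minus_one by (simp add: prime_disc_def)
next
  fix p :: int assume p: "prime p"
  show "Legendre p q = kronecker_prime (prime_disc q) p"
  proof (cases "p = 2")
    case True
    have "odd q" using q prime_odd_int by blast
    moreover from this have "q mod 4 = 1 \<Longrightarrow> q mod 8 \<in> {1,5}" "q mod 4 \<noteq> 1 \<Longrightarrow> q mod 8 \<in> {3,7}"
      by (simp; presburger)+
    moreover have "(- q) mod 8 \<in> {1,7} \<longleftrightarrow> q mod 8 \<in> {1,7}"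
      by simp presburger
    ultimately show ?thesis using True Legendre_two[OF q]
      by (auto simp: kronecker_prime_def prime_disc_def)
  next
    case False
    with p have p2: "p > 2" using prime_ge_2_int[of p] by linarith
    have sgn: "Legendre (- a) p = (if p mod 4 = 1 then 1 else - 1) * Legendre a p" for a
      using Legendre_mult[OF p p2, of "- 1" a] Legendre_minus_one[OF p p2] by simp
    have "Legendre p q = Legendre (prime_disc q) p"
    proof (cases "p = q")
      case True
      then show ?thesis by (simp add: prime_disc_def Legendre_def cong_0_iff)
    next
      case False
      define e where "e = nat ((p - 1) div 2 * ((q - 1) div 2))"
      have "even e \<longleftrightarrow> p mod 4 = 1 \<or> q mod 4 = 1"
      proof -
        have "even e \<longleftrightarrow> even ((p - 1) div 2) \<or> even ((q - 1) div 2)"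
          using p2 q by (simp add: e_def even_nat_iff)
        then show ?thesis
          using odd_prime_mod_4[OF p p2] odd_prime_mod_4[OF q] by presburger
      qed
      moreover have "Legendre p q * Legendre q p = (- 1) ^ e"
        unfolding e_def using p p2 q False
        by (intro Quadratic_Reciprocity_int) auto
      ultimately have "Legendre p q * Legendre q p = (if p mod 4 = 1 \<or> q mod 4 = 1 then 1 else - 1)"
        by (simp add: minus_one_power_iff)
      then show ?thesis
        using Legendre_values[of p q] Legendre_values[of q p] sgn[of q]
        by (auto simp: prime_disc_def split: if_splits)
    qed
    then show ?thesis using False by (simp add: kronecker_prime_def)
  qed
qed

text \<open>The three even prime discriminants: here reciprocity is just the two supplementary laws.\<close>

lemma kronecker_residue_sign:
  assumes "(e, S) \<in> {(- 4, {1, 5}), (8, {1, 7}), (- 8, {1, 3})}" and n: "n \<noteq> 0"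
  shows "kronecker e n = residue_sign S n"
  \<comment> \<open>The blanks leave the four conditions on the function as goals and discharge only \<open>n \<noteq> 0\<close>.\<close>
  using _ _ _ _ n
proof (rule kronecker_eqI)
  fix p n :: int
  show "residue_sign S (p * n) = residue_sign S p * residue_sign S n"
    using assms by (intro residue_sign_mult) auto
next
  show "residue_sign S 1 = 1" "residue_sign S (- 1) = (if e < 0 then - 1 else 1)"
    using assms by (auto simp: residue_sign_def)
next
  fix p :: int assume p: "prime p"
  show "residue_sign S p = kronecker_prime e p"
  proof (cases "p = 2")
    case True
    then show ?thesis using assms by (auto simp: residue_sign_def kronecker_prime_def)
  next
    case False
    with p have p2: "p > 2" using prime_ge_2_int[of p] by linarith
    then have "odd p" using p prime_odd_int by blast
    note L = Legendre_mult[OF p p2] Legendre_minus_one[OF p p2] Legendre_two[OF p p2]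
    have 4: "Legendre 4 p = 1"
      using Legendre_square_eq_1[OF p, of 2] p2 zdvd_not_zless[of 2 p] by simp
    have "Legendre (- 4) p = (if p mod 4 = 1 then 1 else - 1)"
      using L(1)[of "- 1" 4] L(2) 4 by simp
    moreover have 8: "Legendre 8 p = (if p mod 8 \<in> {1, 7} then 1 else - 1)"
      using L(1)[of 2 4] L(3) 4 by simp
    moreover have "Legendre (- 8) p = (if p mod 4 = 1 then 1 else - 1) * Legendre 8 p"
      using L(1)[of "- 1" 8] L(2) by simp
    moreover have "p mod 4 = 1 \<longleftrightarrow> p mod 8 \<in> {1, 5}" by simp presburger
    moreover have "p mod 8 \<in> {1, 3, 5, 7}" using odd_mod_8 \<open>odd p\<close> .
    ultimately show ?thesis
      using assms(1) False \<open>odd p\<close> by (auto simp: residue_sign_def kronecker_prime_def)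
  qed
qed

text \<open>An odd discriminant \<open>s\<close> is the product of the \<open>prime_disc q\<close> over its prime factors \<open>q\<close>,
  counted with multiplicity: both sides have
  the same absolute value and are 1 modulo 4. So its symbol is the product of the Legendre symbols
  \<open>(n/q)\<close>.\<close>

lemma kronecker_locally_square:
  assumes "s mod 4 = 1" "n \<noteq> 0" "\<And>q. prime q \<Longrightarrow> q dvd s \<Longrightarrow> Legendre n q = 1"
  shows "kronecker s n = 1"
  using assms(1,3)
proof (induction "nat \<bar>s\<bar>" arbitrary: s rule: less_induct)
  case less
  show ?case
  proof (cases "is_unit s")
    case True
    then have "s = 1" using less.prems(1) by (auto simp: abs_if split: if_splits)
    then show ?thesis using kronecker_one assms(2) by simp
  next
    case False
    have "s \<noteq> 0" "odd s" using less.prems(1) by presburger+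
    then obtain q where q: "prime q" "q dvd s"
      using prime_divisor_exists False by blast
    have "q \<noteq> 2" using q \<open>odd s\<close> by blast
    with q have q2: "q > 2" using prime_ge_2_int[of q] by linarith
    \<comment> \<open>Split off one prime discriminant; the cofactor is again 1 modulo 4.\<close>
    have "prime_disc q dvd s" using q by (simp add: prime_disc_def)
    then obtain t where t: "s = prime_disc q * t" by auto
    have pd: "prime_disc q mod 4 = 1"
      using odd_prime_mod_4[OF q(1) q2] unfolding prime_disc_def by presburger
    have "(prime_disc q * t) mod 4 = ((prime_disc q mod 4) * t) mod 4" by (simp add: mod_mult_left_eq)
    then have t4: "t mod 4 = 1" using less.prems(1) pd unfolding t by simp
    have t0: "t \<noteq> 0" "prime_disc q \<noteq> 0" using t \<open>s \<noteq> 0\<close> by auto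
    have "\<bar>prime_disc q\<bar> = q" using q2 by (simp add: prime_disc_def)
    then have "\<bar>s\<bar> = q * \<bar>t\<bar>" by (simp add: t abs_mult)
    moreover have "1 * \<bar>t\<bar> < q * \<bar>t\<bar>" using q2 t0 by (intro mult_strict_right_mono) auto
    ultimately have "nat \<bar>t\<bar> < nat \<bar>s\<bar>" by simp
    then have "kronecker t n = 1"
      using t4 by (rule less.hyps) (use less.prems(2) t in auto)
    moreover have "kronecker (prime_disc q) n = 1"
      using kronecker_prime_disc[OF q(1) q2 assms(2)] less.prems(2)[OF q] by simp
    ultimately show ?thesis using t0 by (simp add: t kronecker_mult_left)
  qed
qed

section \<open>Fundamental discriminants modulo 16\<close>

text \<open>A rational square root of an integer is an algebraic integer, hence an integer.\<close>

lemma csqrt_squarefree_irrational: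
  assumes "squarefree m" "m \<noteq> 1"
  shows "csqrt (of_int m) \<notin> \<rat>"
proof
  assume "csqrt (of_int m) \<in> \<rat>"
  moreover have "algebraic_int (csqrt (of_int m))"
    by (intro algebraic_int_csqrt int_imp_algebraic_int) simp
  ultimately obtain k where "csqrt (of_int m) = of_int k"
    using rational_algebraic_int_is_int by (auto elim: Ints_cases)
  then have "(of_int k)\<^sup>2 = (of_int m :: complex)" by (metis power2_csqrt)
  then have m: "m = k\<^sup>2" by (metis of_int_eq_iff of_int_power)
  then have "is_unit k" using squarefreeD[OF assms(1)] by simp
  then have "m = 1" unfolding m by (auto simp: abs_if power2_eq_square split: if_splits)
  with assms(2) show False ..
qed

lemma quad_elt_eq_iff:
  assumes "squarefree m" "m \<noteq> 1"
  shows "quad_elt m u v = quad_elt m u' v' \<longleftrightarrow> u = u' \<and> v = v'"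
proof
  assume eq: "quad_elt m u v = quad_elt m u' v'"
  have "v = v'"
  proof (rule ccontr)
    assume "v \<noteq> v'"
    then have "csqrt (of_int m) = of_rat ((u' - u) / (v - v'))"
      using eq by (simp add: quad_elt_def of_rat_divide of_rat_diff field_simps)
    then show False using csqrt_squarefree_irrational[OF assms] by simp
  qed
  with eq show "u = u' \<and> v = v'" by (simp add: quad_elt_def)
qed auto

lemma quad_elt_linear_combination:
  "of_int s * quad_elt m u v + of_int t * quad_elt m u' v' =
   quad_elt m (of_int s * u + of_int t * u') (of_int s * v + of_int t * v')"
  by (simp add: quad_elt_def of_rat_add of_rat_mult algebra_simps)

text \<open>The square of the denominator of \<open>y\<close> divides \<open>m\<close>.\<close>

lemma Ints_squarefree_mult_square:
  fixes y :: rat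
  assumes "squarefree m" "of_int m * y\<^sup>2 \<in> \<int>"
  shows "y \<in> \<int>"
proof -
  obtain n where n: "of_int m * y\<^sup>2 = of_int n" using assms(2) by (auto elim: Ints_cases)
  obtain p q where "quotient_of y = (p, q)" by fastforce
  then have q: "q > 0" "coprime p q" and y: "y = of_int p / of_int q"
    using quotient_of_denom_pos quotient_of_div quotient_of_coprime by auto
  have "of_int (m * p\<^sup>2) = (of_int (n * q\<^sup>2) :: rat)"
    using n q unfolding y by (simp add: field_simps)
  then have "m * p\<^sup>2 = n * q\<^sup>2" by (simp only: of_int_eq_iff)
  then have "q\<^sup>2 dvd m * p\<^sup>2" by simp
  then have "q\<^sup>2 dvd m" using q by (simp add: coprime_dvd_mult_left_iff coprime_commute)
  then have "is_unit q" using squarefreeD assms(1) by blast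
  then show ?thesis using q by (simp add: y)
qed

lemma poly_of_int_hom:
  fixes z :: complex
  shows poly_of_int_add: "poly (map_poly of_int (p + q)) z = poly (map_poly of_int p) z + poly (map_poly of_int q) z"
    and poly_of_int_smult: "poly (map_poly of_int (Polynomial.smult a p)) z = of_int a * poly (map_poly of_int p) z"
    and poly_of_int_mult: "poly (map_poly of_int (p * q)) z = poly (map_poly of_int p) z * poly (map_poly of_int q) z"
proof -
  show add: "poly (map_poly of_int (p + q)) z = poly (map_poly of_int p) z + poly (map_poly of_int q) z"
    for p q by (induction p q rule: poly_induct2) (simp_all add: map_poly_pCons algebra_simps)
  show smult: "poly (map_poly of_int (Polynomial.smult a p)) z = of_int a * poly (map_poly of_int p) z"
    for a p by (induction p) (simp_all add: map_poly_pCons algebra_simps)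
  show "poly (map_poly of_int (p * q)) z = poly (map_poly of_int p) z * poly (map_poly of_int q) z"
    by (induction p) (simp_all add: map_poly_pCons add smult algebra_simps)
qed

text \<open>Gauss's lemma for a primitive polynomial \<open>f\<close> of minimal degree with root \<open>z\<close>: pseudo-division of a monic
  \<open>p\<close> with root \<open>z\<close> leaves remainder 0, and comparing contents in \<open>a p = f q\<close> shows that
  \<open>a\<close> divides \<open>q\<close>, so \<open>f\<close> divides \<open>p\<close> and its leading coefficient divides 1.\<close>

lemma primitive_annihilator_dvd_monic:
  fixes f p :: "int poly" and z :: complex
  assumes f: "content f = 1" "poly (map_poly of_int f) z = 0"
    and p: "lead_coeff p = 1" "poly (map_poly of_int p) z = 0"
    and minimal: "\<And>r. degree r < degree f \<Longrightarrow> poly (map_poly of_int r) z = 0 \<Longrightarrow> r = 0"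
  shows "is_unit (lead_coeff f)"
proof -
  have "f \<noteq> 0" using f(1) by auto
  define r where "r = pseudo_mod p f"
  obtain a q where a: "a \<noteq> 0" and eq: "Polynomial.smult a p = f * q + r"
    and r: "r = 0 \<or> degree r < degree f"
    using pseudo_mod[OF \<open>f \<noteq> 0\<close>, of p] by (auto simp: r_def)
  have "poly (map_poly of_int (Polynomial.smult a p)) z = poly (map_poly of_int (f * q + r)) z"
    by (simp only: eq)
  then have "poly (map_poly of_int r) z = 0"
    using f p by (simp add: poly_of_int_hom)
  with r minimal have "r = 0" by blast
  with eq have eq: "Polynomial.smult a p = f * q" by simp
  have "content p = 1"
    using content_dvd_coeff[of p "degree p"] p(1) by (metis is_unit_normalize normalize_content)
  then have "content q = normalize a"
    using arg_cong[OF eq, of content] f(1) by (simp add: content_mult)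
  then have "a dvd lead_coeff q" using content_dvd_coeff[of q "degree q"] by (metis normalize_dvd_iff)
  then obtain b where "lead_coeff q = a * b" by blast
  moreover have "a = lead_coeff f * lead_coeff q"
    using arg_cong[OF eq, of lead_coeff] p(1) a by (simp add: lead_coeff_mult)
  ultimately have "a * 1 = a * (lead_coeff f * b)" by simp
  then have "lead_coeff f * b = 1" using a by (metis mult_left_cancel)
  then show ?thesis by (metis dvd_triv_left)
qed

text \<open>Clearing denominators in \<open>X\<^sup>2 - 2 u X + (u\<^sup>2 - m v\<^sup>2)\<close>, which has root \<open>u + v \<surd>m\<close>, and dividing by the content
  gives a primitive polynomial. By Gauss's lemma its leading coefficient is a unit, so the coefficients
  of the monic polynomial were integers already. For \<open>v = 0\<close> the number is rational.\<close>

lemma quadratic_integer_trace_norm: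
  assumes m: "squarefree m" "m \<noteq> 1" and int: "algebraic_int (quad_elt m u v)"
  shows "2 * u \<in> \<int>" "u\<^sup>2 - of_int m * v\<^sup>2 \<in> \<int>"
proof -
  define z where "z = quad_elt m u v"
  define N where "N = u\<^sup>2 - of_int m * v\<^sup>2"
  have "2 * u \<in> \<int> \<and> N \<in> \<int>"
  proof (cases "v = 0")
    case True
    then have "quad_elt m u v = of_rat u" by (simp add: quad_elt_def)
    then have "of_rat u \<in> (\<int> :: complex set)"
      using rational_algebraic_int_is_int[OF int] by simp
    then obtain k where "of_rat u = (of_int k :: complex)" by (auto elim: Ints_cases)
    then have "u = of_int k" by (metis of_rat_eq_iff of_rat_of_int_eq)
    then show ?thesis using True by (simp add: N_def)
  next
    case False
    have quadratic: "z\<^sup>2 = of_rat (2 * u) * z - of_rat N"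
    proof -
      have "(csqrt (of_int m))\<^sup>2 = of_rat (of_int m)" by simp
      then show ?thesis unfolding z_def quad_elt_def N_def
        by (simp add: power2_eq_square of_rat_add of_rat_diff of_rat_mult algebra_simps)
    qed
    obtain p1 q1 where "quotient_of (2 * u) = (p1, q1)" by fastforce
    then have 1: "q1 > 0" "2 * u = of_int p1 / of_int q1"
      using quotient_of_denom_pos quotient_of_div by auto
    obtain p2 q2 where "quotient_of N = (p2, q2)" by fastforce
    then have 2: "q2 > 0" "N = of_int p2 / of_int q2"
      using quotient_of_denom_pos quotient_of_div by auto
    define g where "g = [:p2 * q1, - p1 * q2, q1 * q2:]"
    define f where "f = primitive_part g"
    define c where "c = content g"
    have "g \<noteq> 0" using 1 2 by (simp add: g_def)
    have g: "g = Polynomial.smult c f" by (simp add: c_def f_def)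
    have "c \<noteq> 0" using \<open>g \<noteq> 0\<close> by (simp add: c_def)
    have deg: "degree g = 2" using 1 2 by (simp add: g_def)
    then have degf: "degree f = 2" by (simp add: f_def)
    have coeffs: "q1 * q2 = c * Polynomial.coeff f 2" "- p1 * q2 = c * Polynomial.coeff f 1" "p2 * q1 = c * Polynomial.coeff f 0"
      using arg_cong[OF g, of "\<lambda>p. Polynomial.coeff p 2"] arg_cong[OF g, of "\<lambda>p. Polynomial.coeff p 1"]
        arg_cong[OF g, of "\<lambda>p. Polynomial.coeff p 0"] by (simp_all add: g_def numeral_2_eq_2)
    have "poly (map_poly of_int g) z = of_int (q1 * q2) * (z\<^sup>2 - of_rat (2 * u) * z + of_rat N)"
    proof -
      have "of_int q1 * of_rat (2 * u) = (of_int p1 :: complex)" "of_int q2 * of_rat N = (of_int p2 :: complex)"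
        using 1(1) 2(1) unfolding 1(2) 2(2) by (simp_all add: of_rat_divide)
      then have "of_int p1 = (of_int q1 * of_rat (2 * u) :: complex)" "of_int p2 = (of_int q2 * of_rat N :: complex)"
        by simp_all
      then show ?thesis
        by (simp add: g_def map_poly_pCons power2_eq_square algebra_simps del: of_rat_mult)
    qed
    then have "poly (map_poly of_int g) z = 0" by (simp add: quadratic)
    then have fz: "poly (map_poly of_int f) z = 0" using \<open>c \<noteq> 0\<close> by (simp add: g poly_of_int_smult)
    obtain p where p: "poly (map_poly of_int p) z = 0" "lead_coeff p = 1"
      using int by (auto simp: algebraic_int_altdef_ipoly z_def)
    have minimal: "r = 0" if "degree r < degree f" "poly (map_poly of_int r) z = 0" for r :: "int poly"
    proof -
      have "degree r \<le> 1" using that degf by simp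
      moreover obtain r0 r' where r': "r = pCons r0 r'" by (cases r)
      ultimately have "degree r' = 0" by (simp split: if_splits)
      then obtain r1 where r: "r = [:r0, r1:]" using r' by (auto elim: degree_eq_zeroE)
      then have "of_int r0 * quad_elt m 1 0 + of_int r1 * quad_elt m u v = quad_elt m 0 0"
        using that(2) by (simp add: z_def quad_elt_def map_poly_pCons mult.commute)
      then have "of_int r0 + of_int r1 * u = 0 \<and> of_int r1 * v = 0"
        unfolding quad_elt_linear_combination quad_elt_eq_iff[OF m] by simp
      then show ?thesis using False r by auto
    qed
    have "content f = 1" using \<open>g \<noteq> 0\<close> by (simp add: f_def)
    then have "is_unit (lead_coeff f)"
      using fz p(2,1) minimal by (rule primitive_annihilator_dvd_monic)
    then obtain b where b: "b * Polynomial.coeff f 2 = 1"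
      unfolding degf by (metis dvdE mult.commute)
    have clear: "2 * u * of_int (q1 * q2) = of_int (p1 * q2)" "N * of_int (q1 * q2) = of_int (p2 * q1)"
      using 1 2 by simp_all
    \<comment> \<open>Since \<open>q1 q2 = c f\<^sub>2\<close> with \<open>f\<^sub>2\<close> a unit, a rational with denominator \<open>q1 q2\<close> and numerator divisible by \<open>c\<close> is integral.\<close>
    have integral: "y = of_int (b * l)"
      if "y * of_int (q1 * q2) = of_int k" "k = c * l" for y :: rat and k l
    proof -
      have "of_int c * (y * of_int (Polynomial.coeff f 2)) = of_int c * of_int l"
        using that coeffs(1) by (simp add: mult.commute mult.left_commute)
      then have "y * of_int (Polynomial.coeff f 2) = of_int l" using \<open>c \<noteq> 0\<close> by simp
      then have "y * of_int (b * Polynomial.coeff f 2) = of_int (b * l)"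
        by (simp add: mult.left_commute)
      then show ?thesis by (simp add: b)
    qed
    have "2 * u = of_int (b * - Polynomial.coeff f 1)"
      by (rule integral[OF clear(1)]) (use coeffs(2) in simp)
    moreover have "N = of_int (b * Polynomial.coeff f 0)"
      by (rule integral[OF clear(2)]) (use coeffs(3) in simp)
    ultimately have "2 * u \<in> \<int>" "N \<in> \<int>" by (metis Ints_of_int)+
    then show ?thesis by simp
  qed
  then show "2 * u \<in> \<int>" "u\<^sup>2 - of_int m * v\<^sup>2 \<in> \<int>" by (simp_all add: N_def)
qed

lemma quadratic_integer_half_integral:
  assumes m: "squarefree m" "m \<noteq> 1" and int: "algebraic_int (quad_elt m u v)"
  obtains U V :: int where "2 * u = of_int U" "2 * v = of_int V" "4 dvd U\<^sup>2 - m * V\<^sup>2"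
proof -
  obtain U where U: "2 * u = of_int U"
    using quadratic_integer_trace_norm(1)[OF assms] by (auto elim: Ints_cases)
  obtain N where N: "u\<^sup>2 - of_int m * v\<^sup>2 = of_int N"
    using quadratic_integer_trace_norm(2)[OF assms] by (auto elim: Ints_cases)
  have "of_int m * (2 * v)\<^sup>2 = (2 * u)\<^sup>2 - 4 * (u\<^sup>2 - of_int m * v\<^sup>2)"
    by (simp add: power_mult_distrib)
  then have mV: "of_int m * (2 * v)\<^sup>2 = of_int (U\<^sup>2 - 4 * N)" unfolding U N by simp
  then have "2 * v \<in> \<int>" using Ints_squarefree_mult_square[OF m(1)] by (metis Ints_of_int)
  then obtain V where V: "2 * v = of_int V" by (auto elim: Ints_cases)
  have "of_int (m * V\<^sup>2) = (of_int (U\<^sup>2 - 4 * N) :: rat)" using mV unfolding V by simp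
  then have "m * V\<^sup>2 = U\<^sup>2 - 4 * N" by (simp only: of_int_eq_iff)
  then have "4 dvd U\<^sup>2 - m * V\<^sup>2" by simp
  with U V that show thesis by blast
qed

text \<open>With \<open>m = 4 k + 1\<close> this number is a root of \<open>X\<^sup>2 - X - k\<close>.\<close>

lemma algebraic_int_half_one_plus_sqrt:
  assumes "m mod 4 = 1"
  shows "algebraic_int (quad_elt m (1 / 2) (1 / 2))"
proof -
  obtain k where m: "m = 4 * k + 1" using assms by (metis mult_div_mod_eq)
  define z where "z = quad_elt m (1 / 2) (1 / 2)"
  have "z = (1 + csqrt (of_int m)) / 2" by (simp add: z_def quad_elt_def of_rat_divide field_simps)
  then have "2 * z - 1 = csqrt (of_int m)" by (simp add: algebra_simps)
  then have "(2 * z - 1)\<^sup>2 = of_int m" by (simp only: power2_csqrt)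
  then have "(2 * z - 1)\<^sup>2 = 4 * of_int k + 1" by (simp add: m)
  then have "4 * (z * z - z - of_int k) = 0" by (simp add: power2_eq_square algebra_simps)
  then have "z * z - z - of_int k = 0" by (metis mult_eq_0_iff zero_neq_numeral)
  then show ?thesis unfolding algebraic_int_altdef_ipoly z_def[symmetric]
    by (intro exI[of _ "[:- k, - 1, 1:]"]) (simp add: map_poly_pCons algebra_simps)
qed

text \<open>The discriminant \<open>d\<close> of the field generated by \<open>\<surd>m\<close>, with \<open>m\<close> squarefree, is \<open>m\<close> if \<open>m mod 4 = 1\<close> and \<open>4 m\<close> otherwise; the
  classes modulo 16 then follow as \<open>4\<close> does not divide \<open>m\<close>. In terms of the determinant \<open>\<delta>\<close> of the coordinates
  of the integral basis, \<open>d = 4 m \<delta>\<^sup>2\<close>. Integers of the field have half-integral coordinates subject to a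
  parity condition, which bounds the denominator of \<open>\<delta>\<close>. Conversely the
  determinant of any two integers of the field is an integral multiple of \<open>\<delta>\<close>; with 1 and the
  standard second generator this leaves only \<open>\<delta> = \<plusminus> 1/2\<close> or \<open>\<delta> = \<plusminus> 1\<close>.\<close>

lemma fundamental_discriminant_mod_16:
  assumes "fundamental_discriminant d"
  shows "d mod 4 = 1 \<or> d mod 16 = 12 \<or> d mod 16 = 8"
proof (cases "d = 1")
  case False
  then obtain m u1 v1 u2 v2 where m: "squarefree m" "m \<noteq> 1"
    and basis: "bij_betw (\<lambda>(s, t). of_int s * quad_elt m u1 v1 + of_int t * quad_elt m u2 v2)
      UNIV (quadratic_integers m)" (is "bij_betw ?f _ _")
    and d: "of_int d = (quad_elt m u1 v1 * quad_elt m u2 (- v2) - quad_elt m u2 v2 * quad_elt m u1 (- v1))\<^sup>2"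
    using assms unfolding fundamental_discriminant_def is_field_discriminant_def by blast
  define \<delta> where "\<delta> = u2 * v1 - u1 * v2"
  have "of_int d = (2 * of_rat \<delta> * csqrt (of_int m))\<^sup>2"
    unfolding d quad_elt_def \<delta>_def
    by (simp add: of_rat_diff of_rat_mult of_rat_minus algebra_simps)
  also have "\<dots> = of_rat (4 * of_int m * \<delta>\<^sup>2)"
    by (simp add: power_mult_distrib of_rat_mult of_rat_power)
  finally have "of_rat (of_int d) = (of_rat (4 * of_int m * \<delta>\<^sup>2) :: complex)" by simp
  then have d_eq: "of_int d = 4 * of_int m * \<delta>\<^sup>2" by (simp only: of_rat_eq_iff)
  have "?f (1, 0) \<in> quadratic_integers m" "?f (0, 1) \<in> quadratic_integers m"
    using basis by (blast dest: bij_betwE)+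
  then have int: "algebraic_int (quad_elt m u1 v1)" "algebraic_int (quad_elt m u2 v2)"
    by (simp_all add: quadratic_integers_def)
  obtain U1 V1 where 1: "2 * u1 = of_int U1" "2 * v1 = of_int V1" "4 dvd U1\<^sup>2 - m * V1\<^sup>2"
    using quadratic_integer_half_integral[OF m int(1)] .
  obtain U2 V2 where 2: "2 * u2 = of_int U2" "2 * v2 = of_int V2" "4 dvd U2\<^sup>2 - m * V2\<^sup>2"
    using quadratic_integer_half_integral[OF m int(2)] .
  have "4 * \<delta> = (2 * u2) * (2 * v1) - (2 * u1) * (2 * v2)" by (simp add: \<delta>_def)
  then have \<delta>: "4 * \<delta> = of_int (U2 * V1 - U1 * V2)" unfolding 1 2 by simp
  have covolume: "\<exists>k. x * y' - x' * y = of_int k * \<delta>"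
    if "algebraic_int (quad_elt m x y)" "algebraic_int (quad_elt m x' y')" for x y x' y'
  proof -
    have "\<exists>s t. x = of_int s * u1 + of_int t * u2 \<and> y = of_int s * v1 + of_int t * v2"
      if "algebraic_int (quad_elt m x y)" for x y
    proof -
      have "quad_elt m x y \<in> ?f ` UNIV"
        using that basis by (auto simp: quadratic_integers_def quadratic_field_def bij_betw_def)
      then obtain s t where "x = of_int s * u1 + of_int t * u2" "y = of_int s * v1 + of_int t * v2"
        by (auto simp: quad_elt_linear_combination quad_elt_eq_iff[OF m])
      then show ?thesis by blast
    qed
    from this[OF that(1)] this[OF that(2)] obtain s t s' t' where
      "x = of_int s * u1 + of_int t * u2" "y = of_int s * v1 + of_int t * v2"
      "x' = of_int s' * u1 + of_int t' * u2" "y' = of_int s' * v1 + of_int t' * v2"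
      by blast
    then have "x * y' - x' * y = of_int (s' * t - s * t') * \<delta>"
      by (simp add: \<delta>_def algebra_simps)
    then show ?thesis by blast
  qed
  have int_1: "algebraic_int (quad_elt m 1 0)" by (simp add: quad_elt_def)
  have int_sqrt: "algebraic_int (quad_elt m 0 1)"
    using algebraic_int_csqrt[OF int_imp_algebraic_int, of "of_int m"] by (simp add: quad_elt_def)
  have "m mod 4 \<noteq> 0"
  proof
    assume "m mod 4 = 0"
    then have "2\<^sup>2 dvd m" by auto
    then have "is_unit (2 :: int)" using squarefreeD m(1) by blast
    then show False by simp
  qed
  then have "m mod 4 = 1 \<or> m mod 4 = 2 \<or> m mod 4 = 3" by presburger
  then consider "m mod 4 = 1" | "m mod 4 = 2 \<or> m mod 4 = 3" by blast
  then show ?thesis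
  proof cases
    case m4: 1
    then have "odd m" by presburger
    \<comment> \<open>Here the two coordinates have equal parity, so \<open>2 \<delta>\<close> is integral.\<close>
    have "even x" if "4 dvd x" for x :: int using that by presburger
    then have "even (U1\<^sup>2 - m * V1\<^sup>2)" "even (U2\<^sup>2 - m * V2\<^sup>2)"
      using 1(3) 2(3) by blast+
    then have "even (U2 * V1 - U1 * V2)" using \<open>odd m\<close> by auto
    then obtain e where e: "U2 * V1 - U1 * V2 = 2 * e" by blast
    have \<delta>: "2 * \<delta> = of_int e" using \<delta> unfolding e by simp
    obtain k where "1 / 2 = of_int k * \<delta>"
      using covolume[OF int_1 algebraic_int_half_one_plus_sqrt[OF m4]] by auto
    then have "of_int (k * e) = (1 :: rat)" by (simp flip: \<delta>)
    then have "k * e = 1" by (simp only: of_int_eq_1_iff)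
    then have "e\<^sup>2 = 1" by (auto simp: zmult_eq_1_iff)
    have "of_int d = of_int m * (2 * \<delta>)\<^sup>2" by (simp add: d_eq power_mult_distrib)
    then have "of_int d = (of_int (m * e\<^sup>2) :: rat)" unfolding \<delta> by simp
    then have "d = m" using \<open>e\<^sup>2 = 1\<close> by simp
    with m4 show ?thesis by simp
  next
    case m4: 2
    \<comment> \<open>Here the coordinates are integral, as squares are 0 or 1 modulo 4, and so is \<open>\<delta>\<close>.\<close>
    have even: "even U \<and> even V" if "4 dvd U\<^sup>2 - m * V\<^sup>2" for U V
    proof -
      have "U\<^sup>2 mod 4 = m * V\<^sup>2 mod 4" using that by (simp add: mod_eq_dvd_iff)
      also have "m * V\<^sup>2 mod 4 = (m mod 4) * (V\<^sup>2 mod 4) mod 4" by (simp add: mod_mult_eq)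
      finally have eq: "U\<^sup>2 mod 4 = (m mod 4) * (V\<^sup>2 mod 4) mod 4" .
      have sq: "x\<^sup>2 mod 4 = (if even x then 0 else 1)" for x :: int
      proof -
        have "x\<^sup>2 mod 4 = (x mod 4)\<^sup>2 mod 4" by (simp add: power_mod)
        moreover have "x mod 4 \<in> (if even x then {0, 2} else {1, 3})" by simp presburger
        ultimately show ?thesis by (auto split: if_splits)
      qed
      show ?thesis using eq m4 unfolding sq by (auto split: if_splits)
    qed
    obtain r s r' s' where "U1 = 2 * r" "V1 = 2 * s" "U2 = 2 * r'" "V2 = 2 * s'"
      using even[OF 1(3)] even[OF 2(3)] by (meson evenE)
    then have "U2 * V1 - U1 * V2 = 4 * (r' * s - r * s')" by (simp add: algebra_simps)
    then obtain e where e: "U2 * V1 - U1 * V2 = 4 * e" by blast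
    have \<delta>: "\<delta> = of_int e" using \<delta> unfolding e by simp
    obtain k where "1 = of_int k * \<delta>" using covolume[OF int_1 int_sqrt] by auto
    then have "of_int (k * e) = (1 :: rat)" by (simp flip: \<delta>)
    then have "k * e = 1" by (simp only: of_int_eq_1_iff)
    then have "e\<^sup>2 = 1" by (auto simp: zmult_eq_1_iff)
    have "of_int d = (of_int (4 * m * e\<^sup>2) :: rat)" unfolding d_eq \<delta> by simp
    then have "d = 4 * m" using \<open>e\<^sup>2 = 1\<close> by simp
    then have "d mod 16 = 4 * (m mod 4)" using mod_mult_mult1[of 4 m 4] by simp
    with m4 show ?thesis by auto
  qed
qed simp

section \<open>Independence of the genus character of the represented integer\<close>

text \<open>Let \<open>X\<close> collect the primes \<open>p\<close> of \<open>d\<close> that divide \<open>a\<close> but not \<open>c\<close>, and \<open>Y\<close> those that do not divide \<open>a\<close>.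
  Then modulo each \<open>p\<close> exactly one of the terms \<open>a X\<^sup>2\<close>, \<open>b X Y\<close>, \<open>c Y\<^sup>2\<close> survives: the first if
  \<open>p\<close> divides \<open>Y\<close>, the last if it divides \<open>X\<close>, and the middle one if \<open>p\<close> divides both \<open>a\<close> and \<open>c\<close>.\<close>

lemma exists_coprime_represented:
  fixes a b c d :: int
  assumes "gcd (gcd a b) (gcd c d) = 1" "d \<noteq> 0"
  shows "\<exists>r. coprime r d \<and> represents (a, b, c) r"
proof -
  define X where "X = (\<Prod>p | p \<in> prime_factors d \<and> p dvd a \<and> \<not> p dvd c. p)"
  define Y where "Y = (\<Prod>p | p \<in> prime_factors d \<and> \<not> p dvd a. p)"
  have X: "p dvd X \<longleftrightarrow> p dvd a \<and> \<not> p dvd c" and Y: "p dvd Y \<longleftrightarrow> \<not> p dvd a"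
    if "p \<in> prime_factors d" for p
  proof -
    have p: "prime p" using that by auto
    have eq: "p dvd q \<longleftrightarrow> p = q" if "q \<in> prime_factors d" for q
      using primes_dvd_imp_eq[of p q] p that by auto
    show "p dvd X \<longleftrightarrow> p dvd a \<and> \<not> p dvd c" "p dvd Y \<longleftrightarrow> \<not> p dvd a"
      unfolding X_def Y_def using p that eq by (auto simp: prime_dvd_prod_iff)
  qed
  define r where "r = a * X\<^sup>2 + b * X * Y + c * Y\<^sup>2"
  have "\<not> p dvd r" if p: "prime p" "p dvd d" for p
  proof
    assume r: "p dvd r"
    have pd: "p \<in> prime_factors d" using p assms(2) by (simp add: in_prime_factors_iff)
    note prime_dvd_mult_iff[OF p(1), simp] prime_dvd_power_iff[OF p(1), simp]
    consider "\<not> p dvd a" | "p dvd a" "\<not> p dvd c" | "p dvd a" "p dvd c" by blast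
    then show False
    proof cases
      case 1
      have "p dvd r - (b * X * Y + c * Y\<^sup>2)" using 1 Y[OF pd] r by (intro dvd_diff) auto
      then show False using 1 X[OF pd] by (simp add: r_def)
    next
      case 2
      have "p dvd r - (a * X\<^sup>2 + b * X * Y)" using 2 X[OF pd] r by (intro dvd_diff) auto
      then show False using 2 Y[OF pd] by (simp add: r_def)
    next
      case 3
      have "\<not> p dvd b"
      proof
        assume "p dvd b"
        then have "p dvd gcd (gcd a b) (gcd c d)" using 3 p(2) by simp
        then show False using assms(1) p(1) not_prime_unit by auto
      qed
      moreover have "p dvd r - (a * X\<^sup>2 + c * Y\<^sup>2)" using 3 r by (intro dvd_diff) auto
      ultimately show False using 3 X[OF pd] Y[OF pd] by (simp add: r_def)
    qed
  qed
  note no_common_prime = this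
  have "coprime r d"
  proof (rule coprimeI)
    fix e assume e: "e dvd r" "e dvd d"
    with assms(2) have "e \<noteq> 0" by auto
    then show "is_unit e" using no_common_prime e
      by (meson prime_divisor_exists dvd_trans)
  qed
  then show ?thesis by (auto simp: r_def)
qed

text \<open>The class of \<open>d\<close> modulo 16 yields \<open>d = e s\<close> with \<open>e\<close> one of \<open>1, -4, 8, -8\<close> and \<open>s mod 4 = 1\<close>. The
  part \<open>s\<close> contributes 1 because \<open>4 n\<close> is a square modulo every odd prime divisor of \<open>d\<close>. For even \<open>d = 4 m\<close> the
  equation becomes \<open>n = C\<^sup>2 - D m T\<^sup>2\<close>. As \<open>D\<close> and \<open>T\<^sup>2\<close> are 0 or 1 modulo 4, this puts
  the odd number \<open>n\<close> in the kernel of the character that belongs to \<open>e\<close>.\<close>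

lemma kronecker_square_form_eq_1:
  assumes d: "d mod 4 = 1 \<or> d mod 16 = 12 \<or> d mod 16 = 8"
    and D: "discriminant D" and n: "n \<noteq> 0" "coprime n d"
    and B: "4 * n = B\<^sup>2 - D * d * T\<^sup>2"
  shows "kronecker d n = 1"
proof -
  have Legendre: "Legendre n q = 1" if q: "prime q" "q > 2" "q dvd d" for q
  proof -
    have "\<not> q dvd n" using q n by (meson coprime_common_divisor not_prime_unit)
    have "\<not> q dvd 2" using q zdvd_not_zless[of 2 q] by simp
    then have "\<not> q dvd 4 * n"
      using q \<open>\<not> q dvd n\<close> prime_dvd_mult_iff[of q 2 2] by (simp add: prime_dvd_mult_iff)
    moreover have "[B\<^sup>2 = 4 * n] (mod q)" using q by (simp add: B cong_iff_dvd_diff)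
    ultimately have "Legendre (4 * n) q = 1" by (auto simp: Legendre_def QuadRes_def cong_0_iff)
    moreover have "Legendre (2\<^sup>2) q = 1" using Legendre_square_eq_1 q \<open>\<not> q dvd 2\<close> by blast
    ultimately show ?thesis using Legendre_mult[of q 4 n] q by simp
  qed
  have odd_part: "kronecker s n = 1" if s: "s mod 4 = 1" "s dvd d" for s
  proof (rule kronecker_locally_square[OF s(1) n(1)])
    fix q assume q: "prime q" "q dvd s"
    have "odd s" using s(1) by presburger
    then have "q \<noteq> 2" using q by blast
    then show "Legendre n q = 1"
      using q s(2) prime_ge_2_int[of q] by (intro Legendre) (auto intro: dvd_trans)
  qed
  have split: "kronecker d n = residue_sign S n"
    if "d = e * s" "s mod 4 = 1" "(e, S) \<in> {(- 4, {1, 5}), (8, {1, 7}), (- 8, {1, 3})}" for e s S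
  proof -
    have "kronecker d n = kronecker e n * kronecker s n"
      unfolding that(1) using that by (intro kronecker_mult_left) auto
    then show ?thesis using odd_part[of s] kronecker_residue_sign[OF that(3) n(1)] that by simp
  qed
  have D': "D mod 4 \<in> {0, 1}" using D by (simp add: discriminant_def)
  have sq8: "x\<^sup>2 mod 8 = 1" if "odd x" for x :: int
  proof -
    have "x\<^sup>2 mod 8 = (x mod 8)\<^sup>2 mod 8" by (simp add: power_mod)
    then show ?thesis using odd_mod_8[OF that] by auto
  qed
  show ?thesis
  proof (cases "d mod 4 = 1")
    case True
    then show ?thesis using odd_part by simp
  next
    case False
    then have "even d" "4 dvd d" using d by presburger+
    then obtain m where m: "d = 4 * m" by auto
    have "B\<^sup>2 = 2 * (2 * n + 2 * D * m * T\<^sup>2)" using B by (simp add: m)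
    then have "even (B\<^sup>2)" by simp
    then obtain C where C: "B = 2 * C" by auto
    define t where "t = D * T\<^sup>2"
    have n_eq: "n = C\<^sup>2 - m * t" using B by (simp add: m C t_def power_mult_distrib algebra_simps)
    have "odd n" using n(2) m by auto
    have T4: "T\<^sup>2 mod 4 \<in> {0, 1}"
    proof (cases "even T")
      case True
      then show ?thesis by (auto simp: power_mult_distrib)
    next
      case False
      then show ?thesis using sq8[of T] by simp presburger
    qed
    have "t mod 4 = (D mod 4) * (T\<^sup>2 mod 4) mod 4" by (simp add: t_def mod_mult_eq)
    then have t: "t mod 4 = 0 \<or> t mod 4 = 1" using D' T4 by auto
    have "d mod 16 = 4 * (m mod 4)" using mod_mult_mult1[of 4 m 4] by (simp add: m)
    then have "m mod 4 = 3 \<or> m mod 4 = 2" using d False by auto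
    then show ?thesis
    proof
      assume m4: "m mod 4 = 3"
      define w where "w = m * t"
      have "w mod 4 = (m mod 4) * (t mod 4) mod 4" by (simp add: w_def mod_mult_eq)
      then have w: "w mod 4 = (if t mod 4 = 0 then 0 else 3)" using m4 t by auto
      have n_eq: "n = C\<^sup>2 - w" by (simp add: n_eq w_def)
      have "n mod 4 = 1"
      proof (cases "t mod 4 = 0")
        case True
        then have w: "w mod 4 = 0" using w by simp
        then have "even w" by presburger
        then have "odd C" using \<open>odd n\<close> unfolding n_eq by auto
        then show ?thesis using w sq8[of C] unfolding n_eq by presburger
      next
        case False
        then have w: "w mod 4 = 3" using w by simp
        then have "odd w" by presburger
        then have "even C" using \<open>odd n\<close> unfolding n_eq by auto
        then obtain E where "C = 2 * E" by auto
        then have "C\<^sup>2 mod 4 = 0" by (simp add: power_mult_distrib)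
        then show ?thesis using w unfolding n_eq by presburger
      qed
      then have "residue_sign {1, 5} n = 1" using \<open>odd n\<close> by (simp add: residue_sign_def) presburger
      moreover have "(- m) mod 4 = 1" using m4 by presburger
      ultimately show ?thesis using split[of "- 4" "- m" "{1, 5}"] by (simp add: m)
    next
      assume m4: "m mod 4 = 2"
      define k where "k = m div 2"
      have k: "m = 2 * k" "k mod 4 = 1 \<or> k mod 4 = 3" using m4 unfolding k_def by presburger+
      have "odd C" using \<open>odd n\<close> unfolding n_eq k by auto
      define w where "w = k * t"
      have w: "w mod 4 = (k mod 4) * (t mod 4) mod 4" by (simp add: w_def mod_mult_eq)
      have n_eq': "n = C\<^sup>2 - 2 * w" by (simp add: n_eq k w_def)
      from k(2) show ?thesis
      proof
        assume k4: "k mod 4 = 1"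
        then have "w mod 4 \<in> {0, 1}" using w t by auto
        then have "n mod 8 \<in> {1, 7}" using sq8[OF \<open>odd C\<close>] unfolding n_eq' by simp presburger
        then show ?thesis using split[of 8 k "{1, 7}"] k4 \<open>odd n\<close> by (simp add: m k residue_sign_def)
      next
        assume k4: "k mod 4 = 3"
        then have "w mod 4 \<in> {0, 3}" using w t by auto
        then have "n mod 8 \<in> {1, 3}" using sq8[OF \<open>odd C\<close>] unfolding n_eq' by simp presburger
        moreover have "(- k) mod 4 = 1" using k4 by presburger
        ultimately show ?thesis
          using split[of "- 8" "- k" "{1, 3}"] \<open>odd n\<close> by (simp add: m k residue_sign_def)
      qed
    qed
  qed
qed

text \<open>The product of two values of a form of discriminant \<open>\<Delta>\<close> satisfies \<open>4 r s = B\<^sup>2 - \<Delta> T\<^sup>2\<close>, where \<open>B / 2\<close> is the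
  value of the polar form and \<open>T\<close> the determinant of the two argument vectors.\<close>

lemma represented_coprime_kronecker_eq:
  assumes neg: "d < 0" and d: "d mod 4 = 1 \<or> d mod 16 = 12 \<or> d mod 16 = 8"
    and D: "discriminant D" and Q: "Q \<in> quads (D * d)"
    and r: "represents Q r" "coprime r d" and s: "represents Q s" "coprime s d"
  shows "kronecker d r = kronecker d s"
proof -
  obtain a b c where abc: "Q = (a, b, c)" by (cases Q)
  obtain X Y Z W where XY: "r = a * X\<^sup>2 + b * X * Y + c * Y\<^sup>2" and ZW: "s = a * Z\<^sup>2 + b * Z * W + c * W\<^sup>2"
    using r s by (auto simp: abc)
  have disc: "D * d = b\<^sup>2 - 4 * a * c" using Q by (simp add: abc quads_def)
  have "d \<noteq> - 1" using d by auto
  then have nonzero: "x \<noteq> 0" if "coprime x d" for x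
    using that neg by (auto simp: abs_if)
  have "4 * (r * s) = (2 * a * X * Z + b * (X * W + Z * Y) + 2 * c * Y * W)\<^sup>2 - D * d * (X * W - Z * Y)\<^sup>2"
    unfolding XY ZW disc by (simp add: power2_eq_square algebra_simps)
  then have "kronecker d (r * s) = 1"
    using kronecker_square_form_eq_1[OF d D] nonzero r s by simp
  then have "kronecker d r * kronecker d s = 1"
    using kronecker_mult_right nonzero r s by simp
  then show ?thesis by (metis zmult_eq_1_iff)
qed

section \<open>Symmetries of the genus character\<close>

text \<open>The effect on coefficients of \<open>x \<mapsto> 1/x\<close> (up to the factor \<open>x\<^sup>2\<close>), \<open>x \<mapsto> x + 1\<close> and \<open>Q \<mapsto> - Q\<close>.\<close>

fun quad_swap :: "quad \<Rightarrow> quad" where "quad_swap (a, b, c) = (c, b, a)"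
fun quad_shift :: "quad \<Rightarrow> quad" where "quad_shift (a, b, c) = (a, 2 * a + b, a + b + c)"
fun quad_neg :: "quad \<Rightarrow> quad" where "quad_neg (a, b, c) = (- a, - b, - c)"

text \<open>The choice of \<open>r\<close> inside the genus character depends only on the set of represented integers. So the
  symmetries that preserve this set preserve the character, whichever \<open>r\<close> is chosen.\<close>

lemma genus_char_represents_cong:
  assumes "\<And>r. represents (a, b, c) r \<longleftrightarrow> represents (a', b', c') r"
    and "gcd (gcd a b) (gcd c d) = gcd (gcd a' b') (gcd c' d)"
  shows "genus_char d (a, b, c) = genus_char d (a', b', c')"
  using assms by (simp del: represents.simps)

lemma genus_char_swap: "genus_char d (quad_swap Q) = genus_char d Q"
proof -
  obtain a b c where Q: "Q = (a, b, c)" by (cases Q)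
  have "represents (c, b, a) r" if rep: "represents (a, b, c) r" for a b c r
  proof -
    obtain X Y where "r = a * X\<^sup>2 + b * X * Y + c * Y\<^sup>2" using rep by auto
    then have "r = c * Y\<^sup>2 + b * Y * X + a * X\<^sup>2" by simp
    then show ?thesis unfolding represents.simps by blast
  qed
  then have "represents (c, b, a) r \<longleftrightarrow> represents (a, b, c) r" for r by blast
  moreover have "gcd (gcd c b) (gcd a d) = gcd (gcd a b) (gcd c d)"
    by (simp add: gcd.commute gcd.left_commute gcd.assoc)
  ultimately show ?thesis unfolding Q quad_swap.simps by (rule genus_char_represents_cong)
qed

lemma genus_char_shift: "genus_char d (quad_shift Q) = genus_char d Q"
proof -
  obtain a b c where Q: "Q = (a, b, c)" by (cases Q)
  have "represents (a, 2 * a + b, a + b + c) r \<longleftrightarrow> represents (a, b, c) r" for r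
  proof
    assume "represents (a, 2 * a + b, a + b + c) r"
    then obtain X Y where "r = a * X\<^sup>2 + (2 * a + b) * X * Y + (a + b + c) * Y\<^sup>2" by auto
    then have "r = a * (X + Y)\<^sup>2 + b * (X + Y) * Y + c * Y\<^sup>2"
      by (simp add: power2_eq_square algebra_simps)
    then show "represents (a, b, c) r" unfolding represents.simps by blast
  next
    assume "represents (a, b, c) r"
    then obtain X Y where "r = a * X\<^sup>2 + b * X * Y + c * Y\<^sup>2" by auto
    then have "r = a * (X - Y)\<^sup>2 + (2 * a + b) * (X - Y) * Y + (a + b + c) * Y\<^sup>2"
      by (simp add: power2_eq_square algebra_simps)
    then show "represents (a, 2 * a + b, a + b + c) r" unfolding represents.simps by blast
  qed
  moreover have "gcd (gcd a (2 * a + b)) (gcd (a + b + c) d) = gcd (gcd a b) (gcd c d)"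
  proof (rule zdvd_antisym_nonneg)
    let ?g = "gcd (gcd a (2 * a + b)) (gcd (a + b + c) d)" and ?h = "gcd (gcd a b) (gcd c d)"
    have g: "?g dvd a" "?g dvd 2 * a + b" "?g dvd a + b + c" "?g dvd d"
      by (meson dvd_trans gcd_dvd1 gcd_dvd2)+
    then have "?g dvd b" using dvd_diff[OF g(2) dvd_mult[OF g(1), of 2]] by simp
    moreover from this have "?g dvd c" using dvd_diff[OF g(3) dvd_add[OF g(1), of b]] by simp
    ultimately show "?g dvd ?h" using g by simp
    have "?h dvd a" "?h dvd b" "?h dvd c" "?h dvd d"
      by (meson dvd_trans gcd_dvd1 gcd_dvd2)+
    then show "?h dvd ?g" by simp
  qed simp_all
  ultimately show ?thesis unfolding Q quad_shift.simps by (rule genus_char_represents_cong)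
qed

text \<open>If \<open>r'\<close> is chosen for \<open>- Q\<close>, then \<open>- r'\<close> is represented by \<open>Q\<close> but need not be the integer chosen there;
  independence of the choice reduces the claim to \<open>(d/-r') = - (d/r')\<close>.\<close>

lemma genus_char_neg:
  assumes neg: "d < 0" and d: "d mod 4 = 1 \<or> d mod 16 = 12 \<or> d mod 16 = 8"
    and D: "discriminant D" and Q: "(a, b, c) \<in> quads (D * d)"
  shows "genus_char d (- a, - b, - c) = - genus_char d (a, b, c)"
proof (cases "gcd (gcd a b) (gcd c d) > 1")
  case False
  let ?P = "\<lambda>r. coprime r d \<and> represents (a, b, c) r"
  let ?P' = "\<lambda>r. coprime r d \<and> represents (- a, - b, - c) r"
  have rep_neg: "represents (- a, - b, - c) r \<longleftrightarrow> represents (a, b, c) (- r)" for r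
  proof -
    have "r = - a * X\<^sup>2 + - b * X * Y + - c * Y\<^sup>2 \<longleftrightarrow> - r = a * X\<^sup>2 + b * X * Y + c * Y\<^sup>2"
      for X Y by auto
    then show ?thesis by simp
  qed
  have "gcd (gcd a b) (gcd c d) \<noteq> 0" using neg by simp
  with False have "gcd (gcd a b) (gcd c d) = 1" using gcd_ge_0_int[of "gcd a b" "gcd c d"] by linarith
  then have ex: "\<exists>r. ?P r" using neg by (intro exists_coprime_represented) auto
  then have "\<exists>r. ?P' (- r)" by (simp add: rep_neg del: represents.simps)
  then have "\<exists>r. ?P' r" by blast
  then have r': "?P' (Eps ?P')" by (rule someI_ex)
  have r: "?P (Eps ?P)" using ex by (rule someI_ex)
  have "Eps ?P' \<noteq> 0"
  proof
    assume "Eps ?P' = 0"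
    with r' have "\<bar>d\<bar> = 1" by simp
    with neg have "d = - 1" by simp
    with d show False by simp
  qed
  then have "kronecker d (- Eps ?P') = - kronecker d (Eps ?P')"
    using kronecker_mult_right[of "- 1" "Eps ?P'" d] neg by (simp add: kronecker_minus_one)
  moreover have "kronecker d (Eps ?P) = kronecker d (- Eps ?P')"
    using r r' unfolding rep_neg
    by (intro represented_coprime_kronecker_eq[OF neg d D Q]) auto
  ultimately show ?thesis using False by (simp del: represents.simps)
qed simp

section \<open>Sums of odd invariant functions over quadratic forms\<close>

text \<open>Euclid's algorithm on numerator and denominator: reduce the numerator modulo the denominator by
  translations, then exchange the two by inversion.\<close>

lemma shift_inversion_invariant_imp_const:
  fixes f :: "rat \<Rightarrow> 'a"
  assumes shift: "\<And>x. f (x + 1) = f x" and invert: "\<And>x. x \<noteq> 0 \<Longrightarrow> f (1 / x) = f x"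
  shows "f x = f 0"
proof -
  have shift_int: "f (x + of_int n) = f x" for x and n :: int
  proof (induction n rule: int_induct[where k = 0])
    case (step1 i)
    then show ?case using shift[of "x + of_int i"] by (simp add: add.assoc)
  next
    case (step2 i)
    then show ?case using shift[of "x + of_int (i - 1)"] by (simp add: add.assoc)
  qed simp
  have "f (of_int p / of_int (int n)) = f 0" if "n > 0" for p :: int and n :: nat
    using that
  proof (induction n arbitrary: p rule: less_induct)
    case (less n)
    define k where "k = p div int n"
    define r where "r = p mod int n"
    have r: "0 \<le> r" "r < int n" and p: "p = r + int n * k"
      using less.prems by (simp_all add: k_def r_def)
    have "f (of_int p / of_int (int n)) = f (of_int r / of_int (int n) + of_int k)"
      using less.prems by (simp add: p field_simps)
    also have "\<dots> = f (of_int r / of_int (int n))" by (rule shift_int)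
    also have "\<dots> = f 0"
    proof (cases "r = 0")
      case False
      then have "f (of_int r / of_int (int n)) = f (of_int (int n) / of_int (int (nat r)))"
        using invert[of "of_int r / of_int (int n)"] less.prems r by simp
      also have "\<dots> = f 0" using less.IH[of "nat r" "int n"] False r by simp
      finally show ?thesis .
    qed simp
    finally show ?case .
  qed
  moreover obtain p q where "quotient_of x = (p, q)" by fastforce
  then have "q > 0" "x = of_int p / of_int q"
    using quotient_of_denom_pos quotient_of_div by auto
  ultimately show ?thesis by (metis of_nat_0_less_iff pos_int_cases)
qed

lemma quad_coeffs_nonzero:
  assumes "\<not> is_square \<Delta>" "(a, b, c) \<in> quads \<Delta>"
  shows "a \<noteq> 0" "c \<noteq> 0"
  using assms by (auto simp: quads_def is_nth_power_def)

text \<open>At a root \<open>x\<close> of \<open>Q\<close> the discriminant is the square of \<open>2 a x + b\<close>.\<close>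

lemma quad_eval_nonzero:
  assumes "\<not> is_square \<Delta>" "Q \<in> quads \<Delta>"
  shows "quad_eval Q x \<noteq> 0"
proof
  assume 0: "quad_eval Q x = 0"
  obtain a b c where Q: "Q = (a, b, c)" by (cases Q)
  define y where "y = 2 * of_int a * x + of_int b"
  have \<Delta>: "\<Delta> = b\<^sup>2 - 4 * a * c" using assms(2) by (auto simp: Q quads_def)
  have "y\<^sup>2 = of_int \<Delta> + 4 * of_int a * quad_eval Q x"
    by (simp add: y_def Q \<Delta> power2_eq_square algebra_simps)
  then have y: "y\<^sup>2 = of_int \<Delta>" using 0 by simp
  obtain p q where "quotient_of y = (p, q)" by fastforce
  then have q: "q > 0" "coprime p q" and y': "y = of_int p / of_int q"
    using quotient_of_denom_pos quotient_of_div quotient_of_coprime by auto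
  have "of_int (p\<^sup>2) = (of_int (\<Delta> * q\<^sup>2) :: rat)"
    using y q unfolding y' by (simp add: field_simps)
  then have pq: "p\<^sup>2 = \<Delta> * q\<^sup>2" by (simp only: of_int_eq_iff)
  then have "q\<^sup>2 dvd p\<^sup>2" by simp
  then have "q dvd p" by simp
  with q have "q = 1" by (simp add: coprime_absorb_right)
  with pq assms(1) show False by (auto simp: is_nth_power_def)
qed

text \<open>The forms in \<open>F_index \<Delta> 0\<close> are those with \<open>a < 0 < c\<close>; swapping and negating maps this set to itself.\<close>

lemma sum_index_0_eq_0:
  fixes \<chi> :: "quad \<Rightarrow> rat"
  assumes swap: "\<And>Q. Q \<in> quads \<Delta> \<Longrightarrow> \<chi> (quad_swap Q) = \<chi> Q"
    and neg: "\<And>Q. Q \<in> quads \<Delta> \<Longrightarrow> \<chi> (quad_neg Q) = - \<chi> Q"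
  shows "sum \<chi> (F_index \<Delta> 0) = 0"
proof -
  have "sum \<chi> (F_index \<Delta> 0) = (\<Sum>Q\<in>F_index \<Delta> 0. \<chi> (quad_neg (quad_swap Q)))"
    by (rule sum.reindex_bij_witness[of _ "\<lambda>Q. quad_neg (quad_swap Q)" "\<lambda>Q. quad_neg (quad_swap Q)"])
      (auto simp: F_index_def quads_def)
  also have "\<dots> = (\<Sum>Q\<in>F_index \<Delta> 0. - \<chi> Q)"
    by (rule sum.cong) (use swap neg in \<open>auto simp: F_index_def quads_def algebra_simps\<close>)
  finally show ?thesis by (simp add: sum_negf)
qed

lemma sum_shift:
  fixes \<chi> :: "quad \<Rightarrow> rat"
  assumes shift: "\<And>Q. Q \<in> quads \<Delta> \<Longrightarrow> \<chi> (quad_shift Q) = \<chi> Q"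
  shows "sum \<chi> (F_index \<Delta> (x + 1)) = sum \<chi> (F_index \<Delta> x)"
  by (rule sum.reindex_bij_witness[of _ "\<lambda>(a, b, c). (a, b - 2 * a, a - b + c)" quad_shift])
    (use shift in \<open>auto simp: F_index_def quads_def power2_eq_square algebra_simps\<close>)

text \<open>With \<open>A = F_index \<Delta> x\<close> and \<open>C\<close> the image of \<open>F_index \<Delta> (1 / x)\<close> under the swap, \<open>A - C\<close> and the negatives of
  \<open>C - A\<close> partition the set of forms with \<open>a < 0 < c\<close> by the sign of \<open>Q(x)\<close>. As \<open>\<chi>\<close> is odd, the difference of
  the two sums is the sum over that whole set.\<close>

lemma sum_invert:
  fixes \<chi> :: "quad \<Rightarrow> rat"
  assumes nonsq: "\<not> is_square \<Delta>" and x: "x \<noteq> 0"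
    and swap: "\<And>Q. Q \<in> quads \<Delta> \<Longrightarrow> \<chi> (quad_swap Q) = \<chi> Q"
    and neg: "\<And>Q. Q \<in> quads \<Delta> \<Longrightarrow> \<chi> (quad_neg Q) = - \<chi> Q"
  shows "sum \<chi> (F_index \<Delta> (1 / x)) = sum \<chi> (F_index \<Delta> x)"
proof -
  define C where "C = {(a, b, c) \<in> quads \<Delta>. c < 0 \<and> 0 < quad_eval (a, b, c) x}"
  define T where "T = F_index \<Delta> 0"
  let ?A = "F_index \<Delta> x"
  have swap_eval: "0 < quad_eval (quad_swap Q) x \<longleftrightarrow> 0 < quad_eval Q (1 / x)" for Q
  proof -
    have "quad_eval (quad_swap Q) x = x\<^sup>2 * quad_eval Q (1 / x)"
      using x by (cases Q) (simp add: field_simps power2_eq_square)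
    then show ?thesis using x by (simp add: zero_less_mult_iff)
  qed
  have bij: "bij_betw quad_swap (F_index \<Delta> (1 / x)) C"
  proof (rule bij_betw_byWitness[of _ quad_swap])
    show "quad_swap ` F_index \<Delta> (1 / x) \<subseteq> C"
    proof (rule image_subsetI)
      fix Q assume "Q \<in> F_index \<Delta> (1 / x)"
      then show "quad_swap Q \<in> C"
        using swap_eval[of Q] by (cases Q) (auto simp: F_index_def C_def quads_def algebra_simps)
    qed
    show "quad_swap ` C \<subseteq> F_index \<Delta> (1 / x)"
    proof (rule image_subsetI)
      fix Q assume "Q \<in> C"
      then show "quad_swap Q \<in> F_index \<Delta> (1 / x)"
        using swap_eval[of "quad_swap Q"]
        by (cases Q) (auto simp: F_index_def C_def quads_def algebra_simps)
    qed
  qed auto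
  have finC: "finite C" using bij finite_F_index bij_betw_finite by blast
  have "sum \<chi> C = (\<Sum>Q\<in>F_index \<Delta> (1 / x). \<chi> (quad_swap Q))"
    by (rule sum.reindex_bij_betw[OF bij, symmetric])
  also have "\<dots> = sum \<chi> (F_index \<Delta> (1 / x))"
    by (rule sum.cong) (auto simp: F_index_def swap)
  finally have C: "sum \<chi> (F_index \<Delta> (1 / x)) = sum \<chi> C" ..
  have A_minus_C: "?A - C = {Q \<in> T. 0 < quad_eval Q x}"
    using quad_coeffs_nonzero[OF nonsq]
    by (auto simp: F_index_def C_def T_def not_less le_less)
  have "sum \<chi> (C - ?A) = (\<Sum>Q | Q \<in> T \<and> \<not> 0 < quad_eval Q x. \<chi> (quad_neg Q))"
  proof (rule sum.reindex_bij_witness[of _ quad_neg quad_neg])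
    fix Q assume "Q \<in> C - ?A"
    then show "quad_neg Q \<in> {Q \<in> T. \<not> 0 < quad_eval Q x}"
      using quad_coeffs_nonzero[OF nonsq]
      by (cases Q) (force simp: F_index_def C_def T_def quads_def)
  next
    fix Q assume "Q \<in> {Q \<in> T. \<not> 0 < quad_eval Q x}"
    then show "quad_neg Q \<in> C - ?A"
      using quad_eval_nonzero[OF nonsq, of Q x]
      by (cases Q) (auto simp: F_index_def C_def T_def quads_def)
  qed auto
  also have "\<dots> = (\<Sum>Q | Q \<in> T \<and> \<not> 0 < quad_eval Q x. - \<chi> Q)"
    by (rule sum.cong) (auto simp: T_def F_index_def neg)
  also have "\<dots> = - (\<Sum>Q | Q \<in> T \<and> \<not> 0 < quad_eval Q x. \<chi> Q)"
    by (rule sum_negf)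
  finally have C_minus_A: "sum \<chi> (C - ?A) = - (\<Sum>Q | Q \<in> T \<and> \<not> 0 < quad_eval Q x. \<chi> Q)" .
  have finT: "finite T" by (simp add: T_def finite_F_index)
  have T_split: "sum \<chi> T = (\<Sum>Q | Q \<in> T \<and> 0 < quad_eval Q x. \<chi> Q) +
      (\<Sum>Q | Q \<in> T \<and> \<not> 0 < quad_eval Q x. \<chi> Q)"
    using finT by (subst sum.union_disjoint[symmetric]) (auto intro!: sum.cong)
  have "sum \<chi> ?A - sum \<chi> C = sum \<chi> (?A - C) - sum \<chi> (C - ?A)"
    using sum.Int_Diff[of ?A \<chi> C] sum.Int_Diff[of C \<chi> ?A] finite_F_index finC
    by (simp add: Int_commute)
  also have "\<dots> = sum \<chi> T"
    unfolding A_minus_C C_minus_A T_split by simp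
  also have "\<dots> = 0"
    unfolding T_def by (rule sum_index_0_eq_0) (use swap neg in auto)
  finally show ?thesis using C by simp
qed

lemma sum_odd_invariant_zero:
  fixes \<chi> :: "quad \<Rightarrow> rat"
  assumes nonsq: "\<not> is_square \<Delta>"
    and swap: "\<And>Q. Q \<in> quads \<Delta> \<Longrightarrow> \<chi> (quad_swap Q) = \<chi> Q"
    and shift: "\<And>Q. Q \<in> quads \<Delta> \<Longrightarrow> \<chi> (quad_shift Q) = \<chi> Q"
    and neg: "\<And>Q. Q \<in> quads \<Delta> \<Longrightarrow> \<chi> (quad_neg Q) = - \<chi> Q"
  shows "sum \<chi> (F_index \<Delta> x) = 0"
proof -
  have "sum \<chi> (F_index \<Delta> x) = sum \<chi> (F_index \<Delta> 0)"
    by (rule shift_inversion_invariant_imp_const) (use assms sum_shift sum_invert in auto)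
  also have "\<dots> = 0" by (rule sum_index_0_eq_0) (use swap neg in auto)
  finally show ?thesis .
qed

theorem theorem2:
  fixes d D :: int and x :: rat
  assumes "d < 0" and "fundamental_discriminant d"
    and "D < 0" and "discriminant D"
    and "\<not> is_square (D * d)"
  shows "F 1 D d x = 0"
proof -
  define \<chi> :: "quad \<Rightarrow> rat" where "\<chi> = (\<lambda>Q. of_int (genus_char d Q))"
  have "\<chi> (quad_neg Q) = - \<chi> Q" if "Q \<in> quads (D * d)" for Q
    using that genus_char_neg[OF assms(1) fundamental_discriminant_mod_16[OF assms(2)] assms(4)]
    by (cases Q) (simp add: \<chi>_def del: genus_char.simps)
  moreover have "\<chi> (quad_swap Q) = \<chi> Q" "\<chi> (quad_shift Q) = \<chi> Q" for Q
    by (simp_all add: \<chi>_def genus_char_swap genus_char_shift)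
  ultimately have "sum \<chi> (F_index (D * d) x) = 0"
    using assms(5) by (intro sum_odd_invariant_zero) auto
  then show ?thesis by (simp add: F_def \<chi>_def)
qed

end
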